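(* Let $X$ be a set, let $Y$ be a nonempty subset of $X$, and let $f\in \overline{T}(X,Y)$. Then $f$ is unit-regular in $\overline{T}(X,Y)$ if and only if the following three conditions hold: (i) $f_{\upharpoonright_Y}$ is unit-regular in $T(Y)$; (ii) $R(f_{\upharpoonright_Y}) = Y\cap R(f)$; (iii) there exist a transversal $T_f$ of $\ker(f)$ and a transversal $T_{(f_{\upharpoonright_Y})}$ of $\ker(f_{\upharpoonright_Y})$ with $T_{(f_{\upharpoonright_Y})} = Y\cap T_f$ such that, setting $C(f) := X\setminus T_f$ and $C(f_{\upharpoonright_Y}) := Y\setminus T_{(f_{\upharpoonright_Y})}$, one has $|C(f)\setminus C(f_{\upharpoonright_Y})| = |D(f)\setminus D(f_{\upharpoonright_Y})|$.
   Context: Maps are written on the right and composed from left to right. $T(X)$ is the semigroup of all maps $X\to X$ under composition. For nonempty $Y\subseteq X$, $\overline{T}(X,Y)=\{f\in T(X) : Yf\subseteq Y\}$, a subsemigroup of $T(X)$ containing the identity map. An element $s$ of a semigroup $S$ with identity is unit-regular in $S$ if there is a unit $u$ of $S$ with $sus=s$. For $f\in\overline{T}(X,Y)$, $f_{\upharpoonright_Y}\in T(Y)$ is the map $Y\to Y$ that agrees with $f$ on $Y$. For a self-map $h:A\to A$: $R(h)=Ah$ is its range, $D(h)=A\setminus R(h)$ (so $D(f)=X\setminus R(f)$ and $D(f_{\upharpoonright_Y})=Y\setminus R(f_{\upharpoonright_Y})$), and $\ker(h)=\{(x,y)\in A\times A : xh=yh\}$, an equivalence relation on $A$. A transversal of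 an equivalence relation is a subset containing exactly one element of each class. $|\cdot|$ denotes cardinality, possibly infinite. *)

theory Defs
  imports "HOL-Algebra.Group" "HOL-Library.Equipollence"
begin

text \<open>
  As for \<^term>\<open>PiE\<close>, self-maps of a set \<open>A\<close> are represented by the extensional functions on \<open>A\<close>, so
  that equality of functions is equality of maps. Maps act on the right in the mathematical text:
  the product \<open>f \<otimes> g\<close> is ``first \<open>f\<close>, then \<open>g\<close>''.
\<close>

definition transf :: "'a set \<Rightarrow> ('a \<Rightarrow> 'a) monoid" where
  "transf A = \<lparr>carrier = A \<rightarrow>\<^sub>E A, mult = (\<lambda>f g. compose A g f), one = (\<lambda>x\<in>A. x)\<rparr>"

definition transf_inv :: "'a set \<Rightarrow> 'a set \<Rightarrow> ('a \<Rightarrow> 'a) monoid" where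
  "transf_inv X Y = (transf X)\<lparr>carrier := {f \<in> carrier (transf X). f ` Y \<subseteq> Y}\<rparr>"

definition unit_regular :: "('b, 'm) monoid_scheme \<Rightarrow> 'b \<Rightarrow> bool" where
  "unit_regular S s \<longleftrightarrow>
     s \<in> carrier S \<and> (\<exists>u \<in> Units S. s \<otimes>\<^bsub>S\<^esub> u \<otimes>\<^bsub>S\<^esub> s = s)"

definition defect :: "'a set \<Rightarrow> ('a \<Rightarrow> 'a) \<Rightarrow> 'a set" where
  "defect A h = A - h ` A"

definition kernel_rel :: "'a set \<Rightarrow> ('a \<Rightarrow> 'a) \<Rightarrow> ('a \<times> 'a) set" where
  "kernel_rel A h = {(x, y) \<in> A \<times> A. h x = h y}"

definition transversal :: "'a set \<Rightarrow> ('a \<times> 'a) set \<Rightarrow> 'a set \<Rightarrow> bool" where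
  "transversal A r T \<longleftrightarrow> T \<subseteq> A \<and> (\<forall>C \<in> A // r. \<exists>!t. t \<in> T \<inter> C)"

lemma equiv_kernel_rel: "equiv A (kernel_rel A h)"
  by (rule equivI) (auto simp: kernel_rel_def refl_on_def sym_def trans_def)

lemma monoid_transf_inv:
  assumes "Y \<subseteq> X"
  shows "monoid (transf_inv X Y)"
proof -
  have carrier: "f \<in> carrier (transf_inv X Y) \<longleftrightarrow> f \<in> extensional X \<and> f \<in> X \<rightarrow> X \<and> f \<in> Y \<rightarrow> Y" for f
    by (auto simp: transf_inv_def transf_def PiE_def)
  have mult: "mult (transf_inv X Y) f g = compose X g f" for f g
    by (simp add: transf_inv_def transf_def)
  have one: "one (transf_inv X Y) = (\<lambda>x\<in>X. x)"
    by (simp add: transf_inv_def transf_def)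
  have closed: "compose X g f \<in> Y \<rightarrow> Y" if "f \<in> Y \<rightarrow> Y" "g \<in> Y \<rightarrow> Y" for f g
    using that assms by (simp add: Pi_iff compose_def subset_iff)
  have id: "(\<lambda>x\<in>X. x) \<in> Y \<rightarrow> Y"
    using assms by (simp add: Pi_iff subset_iff)
  show ?thesis
  proof (rule monoidI, unfold carrier mult one, goal_cases)
    case (1 f g)
    then show ?case using closed[of f g] funcset_compose[of f X X g X] by simp
  next
    case 2
    show ?case using id by simp
  next
    case (3 f g h)
    then show ?case using compose_assoc[of f X X h g] by simp
  next
    case (4 f)
    then show ?case using compose_Id[of f X X] by simp
  next
    case (5 f)
    then show ?case using Id_compose[of f X X] by simp
  qed
qed

lemma transf_inv_self: "transf_inv A A = transf A"
proof -
  have "{f \<in> carrier (transf A). f ` A \<subseteq> A} = carrier (transf A)"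
    by (auto simp: transf_def)
  then show ?thesis by (simp add: transf_inv_def)
qed

lemma monoid_transf: "monoid (transf A)"
  using monoid_transf_inv[of A A] by (simp add: transf_inv_self)

end

theory Submission
  imports Defs
begin

text \<open>
  If a unit \<open>u\<close> satisfies \<open>f u f = f\<close>, then \<open>T = (R(f))u\<close> is a transversal of \<open>ker(f)\<close>, and \<open>u\<close> maps
  \<open>D(f) - D(f|Y)\<close> onto \<open>C(f) - C(f|Y)\<close>. Conversely, a unit \<open>u\<close> is glued from three bijections: one
  of \<open>Y\<close> witnessing the unit-regularity of \<open>f|Y\<close>, the inverse of \<open>f\<close> as a map from \<open>T - Y\<close> onto
  \<open>R(f) - Y\<close>, and one from \<open>X - R(f) - Y\<close> onto \<open>X - T - Y\<close>, which exists by the cardinality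
  condition. The transversal of \<open>ker(f|Y)\<close> given by the first bijection need not be \<open>Y \<inter> T\<close>.
\<close>

lemma carrier_transf_inv:
  "f \<in> carrier (transf_inv X Y) \<longleftrightarrow> f \<in> X \<rightarrow>\<^sub>E X \<and> f ` Y \<subseteq> Y"
  by (auto simp: transf_inv_def transf_def)

lemma mult_transf_inv: "f \<otimes>\<^bsub>transf_inv X Y\<^esub> g = compose X g f"
  by (simp add: transf_inv_def transf_def)

lemma one_transf_inv: "\<one>\<^bsub>transf_inv X Y\<^esub> = (\<lambda>x\<in>X. x)"
  by (simp add: transf_inv_def transf_def)

text \<open>The inverse of a unit also keeps \<open>Y\<close> inside \<open>Y\<close>, so the two
  restrict to mutually inverse maps of \<open>Y\<close>. Bijectivity on \<open>Y\<close> does not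
  follow from bijectivity on \<open>X\<close> when \<open>Y\<close> is infinite: the shift of the
  integers maps the naturals into themselves, but its inverse does not.\<close>

lemma Units_transf_inv_iff:
  assumes "Y \<subseteq> X"
  shows "u \<in> Units (transf_inv X Y) \<longleftrightarrow> u \<in> extensional X \<and> bij_betw u X X \<and> bij_betw u Y Y"
proof
  assume "u \<in> Units (transf_inv X Y)"
  then obtain v where u: "u \<in> X \<rightarrow>\<^sub>E X" "u ` Y \<subseteq> Y" and v: "v \<in> X \<rightarrow>\<^sub>E X" "v ` Y \<subseteq> Y"
    and vu: "compose X u v = (\<lambda>x\<in>X. x)" and uv: "compose X v u = (\<lambda>x\<in>X. x)"
    by (auto simp: Units_def carrier_transf_inv mult_transf_inv one_transf_inv)
  have 1: "u (v x) = x" if "x \<in> X" for x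
    using fun_cong[OF vu, of x] that by (simp add: compose_def)
  have 2: "v (u x) = x" if "x \<in> X" for x
    using fun_cong[OF uv, of x] that by (simp add: compose_def)
  have "bij_betw u X X"
    using u v 1 2 by (intro bij_betw_byWitness[where f' = v]) auto
  moreover have "bij_betw u Y Y"
    using u v 1 2 assms by (intro bij_betw_byWitness[where f' = v]) auto
  ultimately show "u \<in> extensional X \<and> bij_betw u X X \<and> bij_betw u Y Y"
    using u by (auto simp: PiE_def)
next
  assume u: "u \<in> extensional X \<and> bij_betw u X X \<and> bij_betw u Y Y"
  define v where "v = restrict (inv_into X u) X"
  have 1: "u (v x) = x" if "x \<in> X" for x
    using u that bij_betw_inv_into_right[of u X X x] by (simp add: v_def)
  have 2: "v (u x) = x" if "x \<in> X" for x
    using u that by (auto simp: v_def bij_betw_inv_into_left bij_betwE)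
  have vX: "v \<in> X \<rightarrow>\<^sub>E X"
    using u bij_betw_inv_into[of u X X] by (auto simp: v_def bij_betwE)
  \<comment> \<open>Here surjectivity of \<open>u\<close> on \<open>Y\<close> enters: the preimage
    of \<open>y\<close> under the injective \<open>u\<close> already lies in
    \<open>Y\<close>.\<close>
  have "v y \<in> Y" if "y \<in> Y" for y
  proof -
    have "y \<in> u ` Y" using u that by (simp add: bij_betw_def)
    then obtain z where "z \<in> Y" "u z = y" by blast
    then show ?thesis using 2[of z] assms by auto
  qed
  then have "v \<in> carrier (transf_inv X Y)"
    using vX by (auto simp: carrier_transf_inv)
  moreover have "u \<in> carrier (transf_inv X Y)"
    using u by (auto simp: carrier_transf_inv bij_betw_def PiE_def)
  moreover have "compose X u v = (\<lambda>x\<in>X. x)" "compose X v u = (\<lambda>x\<in>X. x)"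
    using 1 2 by (auto simp: compose_def)
  ultimately show "u \<in> Units (transf_inv X Y)"
    by (auto simp: Units_def mult_transf_inv one_transf_inv)
qed

text \<open>Since \<open>f\<close> maps \<open>X\<close> into \<open>X\<close>, only the values of
  \<open>u\<close> on \<open>X\<close> enter the equation, and restricting \<open>u\<close> to
  \<open>X\<close> makes it extensional. This lets the witness be glued later without regard to its
  values off \<open>X\<close>.\<close>

lemma unit_regular_transf_inv_iff:
  assumes "Y \<subseteq> X" and f: "f \<in> carrier (transf_inv X Y)"
  shows "unit_regular (transf_inv X Y) f \<longleftrightarrow>
    (\<exists>u. bij_betw u X X \<and> bij_betw u Y Y \<and> (\<forall>x\<in>X. f (u (f x)) = f x))" (is "_ \<longleftrightarrow> ?R")
proof
  assume "unit_regular (transf_inv X Y) f"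
  then obtain u where u: "bij_betw u X X" "bij_betw u Y Y"
    and eq: "compose X f (compose X u f) = f"
    by (auto simp: unit_regular_def Units_transf_inv_iff[OF assms(1)] mult_transf_inv)
  have "f (u (f x)) = f x" if "x \<in> X" for x
    using fun_cong[OF eq, of x] that by (simp add: compose_def)
  then show ?R using u by blast
next
  assume ?R
  then obtain u where u: "bij_betw u X X" "bij_betw u Y Y" "\<And>x. x \<in> X \<Longrightarrow> f (u (f x)) = f x"
    by blast
  have "bij_betw (restrict u X) X X"
    using u(1) by (subst bij_betw_cong[of X _ u]) auto
  moreover have "bij_betw (restrict u X) Y Y"
    using u(2) assms by (subst bij_betw_cong[of Y _ u]) auto
  ultimately have "restrict u X \<in> Units (transf_inv X Y)"
    using Units_transf_inv_iff[OF assms(1)] by auto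
  moreover have "compose X f (compose X (restrict u X) f) = f"
  proof
    fix x
    show "compose X f (compose X (restrict u X) f) x = f x"
    proof (cases "x \<in> X")
      case True
      then have "f x \<in> X" using f by (auto simp: carrier_transf_inv)
      then show ?thesis using True u(3) by (simp add: compose_def)
    next
      case False
      then show ?thesis using f by (auto simp: compose_def carrier_transf_inv PiE_def extensional_def)
    qed
  qed
  ultimately show "unit_regular (transf_inv X Y) f"
    using f by (auto simp: unit_regular_def mult_transf_inv)
qed

lemma unit_regular_transf_restrict_iff:
  assumes "f ` Y \<subseteq> Y"
  shows "unit_regular (transf Y) (restrict f Y) \<longleftrightarrow>
    (\<exists>u. bij_betw u Y Y \<and> (\<forall>y\<in>Y. f (u (f y)) = f y))"
proof -
  have "restrict f Y \<in> carrier (transf_inv Y Y)"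
    using assms by (auto simp: carrier_transf_inv)
  moreover have "restrict f Y (u (restrict f Y y)) = f (u (f y))"
    if "bij_betw u Y Y" "y \<in> Y" for u y
    using that assms by (auto simp: bij_betwE)
  ultimately show ?thesis
    using unit_regular_transf_inv_iff[of Y Y "restrict f Y"]
    by (simp add: transf_inv_self cong: conj_cong)
qed

text \<open>The kernel classes are the nonempty fibres of \<open>h\<close>, one for each point of
  its range. Meeting each fibre at most once is injectivity on \<open>T\<close>, and at least once
  is surjectivity onto the range.\<close>

lemma transversal_kernel_rel_iff:
  "transversal A (kernel_rel A h) T \<longleftrightarrow> T \<subseteq> A \<and> bij_betw h T (h ` A)"
proof -
  have "(\<forall>C \<in> A // kernel_rel A h. \<exists>!t. t \<in> T \<inter> C) \<longleftrightarrow> (\<forall>a\<in>A. \<exists>!t. t \<in> T \<and> h t = h a)"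
    if "T \<subseteq> A"
  proof -
    have "t \<in> T \<inter> (kernel_rel A h `` {a}) \<longleftrightarrow> t \<in> T \<and> h t = h a" if "a \<in> A" for a t
      using \<open>T \<subseteq> A\<close> that by (auto simp: kernel_rel_def)
    then show ?thesis by (simp add: quotient_def)
  qed
  moreover have "(\<forall>a\<in>A. \<exists>!t. t \<in> T \<and> h t = h a) \<longleftrightarrow> bij_betw h T (h ` A)" if "T \<subseteq> A"
  proof
    assume *: "\<forall>a\<in>A. \<exists>!t. t \<in> T \<and> h t = h a"
    then have "inj_on h T" using that by (intro inj_onI) blast
    moreover have "h ` T = h ` A"
    proof
      show "h ` A \<subseteq> h ` T"
      proof
        fix b assume "b \<in> h ` A"
        then obtain t where "t \<in> T" "h t = b" using * by blast
        then show "b \<in> h ` T" by blast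
      qed
    qed (use that in blast)
    ultimately show "bij_betw h T (h ` A)" by (simp add: bij_betw_def)
  next
    assume "bij_betw h T (h ` A)"
    then have inj: "inj_on h T" and im: "h ` T = h ` A" by (auto simp: bij_betw_def)
    show "\<forall>a\<in>A. \<exists>!t. t \<in> T \<and> h t = h a"
    proof
      fix a assume "a \<in> A"
      then obtain t where "t \<in> T" "h t = h a" using im by (metis imageE imageI)
      then show "\<exists>!t. t \<in> T \<and> h t = h a" using inj by (metis inj_onD)
    qed
  qed
  ultimately show ?thesis by (simp add: transversal_def cong: conj_cong)
qed

lemma transversal_restrict_kernel_rel_iff:
  "transversal A (kernel_rel A (restrict h A)) T \<longleftrightarrow> T \<subseteq> A \<and> bij_betw h T (h ` A)"
proof -
  have "kernel_rel A (restrict h A) = kernel_rel A h"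
    by (auto simp: kernel_rel_def)
  then show ?thesis by (simp add: transversal_kernel_rel_iff)
qed

theorem theorem3p2:
  fixes X Y :: "'a set" and f :: "'a \<Rightarrow> 'a"
  assumes "Y \<subseteq> X" and "Y \<noteq> {}" and "f \<in> carrier (transf_inv X Y)"
  shows "unit_regular (transf_inv X Y) f \<longleftrightarrow>
    unit_regular (transf Y) (restrict f Y) \<and>
    restrict f Y ` Y = Y \<inter> f ` X \<and>
    (\<exists>T T'. transversal X (kernel_rel X f) T \<and>
            transversal Y (kernel_rel Y (restrict f Y)) T' \<and>
            T' = Y \<inter> T \<and>
            (X - T) - (Y - T') \<approx> defect X f - defect Y (restrict f Y))"
    (is "?L \<longleftrightarrow> ?R")
proof -
  have fX: "f ` X \<subseteq> X" and fY: "f ` Y \<subseteq> Y"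
    using assms(3) by (auto simp: carrier_transf_inv)
  \<comment> \<open>Used with \<open>A = T\<close> and, by condition (ii), with \<open>A\<close> the
    range R(f): both sides of the cardinality condition become complements in \<open>X\<close> of a
    union with \<open>Y\<close>.\<close>
  have minus: "(X - A) - (Y - Y \<inter> A) = X - A - Y" for A
    by auto
  have R: "?R \<longleftrightarrow> (\<exists>u. bij_betw u Y Y \<and> (\<forall>y\<in>Y. f (u (f y)) = f y)) \<and> f ` Y = Y \<inter> f ` X \<and>
    (\<exists>T\<subseteq>X. bij_betw f T (f ` X) \<and> bij_betw f (Y \<inter> T) (f ` Y) \<and> X - T - Y \<approx> X - f ` X - Y)"
    unfolding transversal_restrict_kernel_rel_iff
    by (auto simp: unit_regular_transf_restrict_iff[OF fY] transversal_kernel_rel_iff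
        defect_def minus)
  show ?thesis unfolding R unit_regular_transf_inv_iff[OF assms(1,3)]
  proof (intro iffI; elim exE conjE)
    fix u assume u: "bij_betw u X X" "bij_betw u Y Y" and fuf: "\<forall>x\<in>X. f (u (f x)) = f x"
    have uX: "u ` X = X" and uY: "u ` Y = Y" and inj: "inj_on u X"
      using u by (auto simp: bij_betw_def)
    \<comment> \<open>For \<open>y\<close> in both \<open>Y\<close> and R(f), the point
      \<open>u y\<close> is a preimage of \<open>y\<close> under \<open>f\<close> that lies in
      \<open>Y\<close>.\<close>
    have fY_eq: "f ` Y = Y \<inter> f ` X"
    proof
      show "Y \<inter> f ` X \<subseteq> f ` Y"
      proof
        fix y assume "y \<in> Y \<inter> f ` X"
        then have "u y \<in> Y" "f (u y) = y" using uY fuf by auto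
        then show "y \<in> f ` Y" by force
      qed
    qed (use fY assms(1) in auto)
    define T where "T = u ` f ` X"
    have "T \<subseteq> X" using fX uX by (auto simp: T_def)
    have YT: "Y \<inter> T = u ` f ` Y"
      unfolding T_def fY_eq using inj uY fX assms(1)
      by (metis inj_on_image_Int)
    \<comment> \<open>On R(f) the equation reads \<open>f (u y) = y\<close>, so \<open>u\<close> and
      \<open>f\<close> are mutually inverse between R(f) and \<open>T\<close>.\<close>
    have "bij_betw f T (f ` X)"
      unfolding T_def using fuf by (intro bij_betw_byWitness[where f' = u]) auto
    moreover have "bij_betw f (Y \<inter> T) (f ` Y)"
      unfolding YT using fuf assms(1) by (intro bij_betw_byWitness[where f' = u]) auto
    \<comment> \<open>The injective \<open>u\<close> maps \<open>X\<close> onto \<open>X\<close>,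
      \<open>Y\<close> onto \<open>Y\<close> and R(f) onto \<open>T\<close>, hence also the
      differences onto each other.\<close>
    moreover have "u ` (X - f ` X - Y) = X - T - Y"
    proof -
      have "u ` (X - f ` X - Y) = u ` (X - f ` X) - u ` Y"
        using inj assms(1) by (intro inj_on_image_set_diff) auto
      also have "u ` (X - f ` X) = u ` X - u ` f ` X"
        using inj fX by (intro inj_on_image_set_diff) auto
      finally show ?thesis by (simp add: T_def uX uY)
    qed
    then have "bij_betw u (X - f ` X - Y) (X - T - Y)"
      using inj by (auto simp: bij_betw_def intro: inj_on_subset)
    then have "X - T - Y \<approx> X - f ` X - Y"
      using eqpoll_def eqpoll_sym by blast
    ultimately show "(\<exists>u. bij_betw u Y Y \<and> (\<forall>y\<in>Y. f (u (f y)) = f y)) \<and> f ` Y = Y \<inter> f ` X \<and>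
        (\<exists>T\<subseteq>X. bij_betw f T (f ` X) \<and> bij_betw f (Y \<inter> T) (f ` Y) \<and> X - T - Y \<approx> X - f ` X - Y)"
      using u(2) fuf fY_eq assms(1) \<open>T \<subseteq> X\<close> by blast
  next
    fix v T assume v: "bij_betw v Y Y" and fvf: "\<forall>y\<in>Y. f (v (f y)) = f y"
      and fY_eq: "f ` Y = Y \<inter> f ` X"
      and "T \<subseteq> X" and T: "bij_betw f T (f ` X)" and YT: "bij_betw f (Y \<inter> T) (f ` Y)"
      and "X - T - Y \<approx> X - f ` X - Y"
    then obtain w where w: "bij_betw w (X - f ` X - Y) (X - T - Y)"
      by (meson eqpoll_def eqpoll_sym)
    define t where "t = inv_into T f"
    \<comment> \<open>On all of \<open>Y\<close> the given \<open>v\<close> is used, even at points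
      of R(f) where \<open>t\<close> is defined: \<open>t\<close> takes over only outside
      \<open>Y\<close>, where it lands in \<open>T - Y\<close>.\<close>
    define u where "u x = (if x \<in> Y then v x else if x \<in> f ` X then t x else w x)" for x
    have ft: "f (t y) = y" if "y \<in> f ` X" for y
      using T that by (simp add: t_def bij_betw_inv_into_right)
    \<comment> \<open>Injectivity of \<open>f\<close> on \<open>T\<close> turns the image of the
      difference into a difference of images. The subtracted image is R(f|Y), because
      \<open>Y \<inter> T\<close> is a transversal of ker(f|Y), and condition (ii) makes the result
      R(f) without \<open>Y\<close>.\<close>
    have "f ` (T - Y) = f ` T - f ` (Y \<inter> T)"
      using T inj_on_image_set_diff[of f T T "Y \<inter> T"]
      by (auto simp: bij_betw_def Diff_Int)
    then have "f ` (T - Y) = f ` X - Y"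
      using T YT fY_eq by (auto simp: bij_betw_def)
    then have "bij_betw t (f ` X - Y) (T - Y)"
      unfolding t_def using T by (intro bij_betw_inv_into_subset[OF T]) auto
    then have tu: "bij_betw u (f ` X - Y) (T - Y)"
      by (subst bij_betw_cong[of _ u t]) (auto simp: u_def)
    have wu: "bij_betw u (X - f ` X - Y) (X - T - Y)"
      using w by (subst bij_betw_cong[of _ u w]) (auto simp: u_def)
    have vu: "bij_betw u Y Y"
      using v by (subst bij_betw_cong[of _ u v]) (auto simp: u_def)
    \<comment> \<open>The three domains are disjoint, and so are the three images; each triple has
      union \<open>X\<close>, as the next fact shows with \<open>A\<close> equal to R(f) and to
      \<open>T\<close>.\<close>
    have "bij_betw u (Y \<union> ((f ` X - Y) \<union> (X - f ` X - Y))) (Y \<union> ((T - Y) \<union> (X - T - Y)))"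
      by (intro bij_betw_combine vu tu wu) auto
    moreover have "Y \<union> ((A - Y) \<union> (X - A - Y)) = X" if "A \<subseteq> X" for A
      using that assms(1) by auto
    ultimately have "bij_betw u X X" using fX \<open>T \<subseteq> X\<close> by simp
    moreover have "f (u (f x)) = f x" if "x \<in> X" for x
    proof (cases "f x \<in> Y")
      case True
      \<comment> \<open>Although \<open>x\<close> may lie outside \<open>Y\<close>, condition (ii)
        gives a point of \<open>Y\<close> with the same value, to which the equation for
        \<open>v\<close> applies.\<close>
      then have "f x \<in> f ` Y" unfolding fY_eq using that by simp
      then obtain y where y: "y \<in> Y" "f x = f y" by blast
      have "f (v (f y)) = f y" using fvf y(1) by (rule bspec)
      then show ?thesis using True y(2) by (simp add: u_def)
    next
      case False
      then show ?thesis using that ft by (simp add: u_def)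
    qed
    ultimately show "\<exists>u. bij_betw u X X \<and> bij_betw u Y Y \<and> (\<forall>x\<in>X. f (u (f x)) = f x)"
      using vu by blast
  qed
qed

end
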